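(* Let $\hat{\boldsymbol{x}}\in\mathcal{F}$ be a feasible point of the QCQP that satisfies the LICQ condition. Then, for all sufficiently large $\eta>0$, the penalized SDP with parameters $(\hat{\boldsymbol{x}},\eta,r)$ has a unique optimal solution $(\boldsymbol{x}^{\ast},\boldsymbol{X}^{\ast})$, and it satisfies $\boldsymbol{X}^{\ast}=\boldsymbol{x}^{\ast}(\boldsymbol{x}^{\ast})^{\top}$. Moreover, $\boldsymbol{x}^{\ast}$ is feasible for the QCQP and satisfies $q_0(\boldsymbol{x}^{\ast})\leq q_0(\hat{\boldsymbol{x}})$.
   Context: $\mathbb{S}_n$ is the set of $n\times n$ real symmetric matrices and $\langle\cdot,\cdot\rangle$ is the Frobenius inner product. QCQP: let $\mathcal{I}$ and $\mathcal{E}$ be disjoint finite index sets. For each $k\in\{0\}\cup\mathcal{I}\cup\mathcal{E}$ let $q_k(\boldsymbol{x})=\boldsymbol{x}^{\top}\boldsymbol{A}_k\boldsymbol{x}+2\boldsymbol{b}_k^{\top}\boldsymbol{x}+c_k$ with $\boldsymbol{A}_k\in\mathbb{S}_n$, $\boldsymbol{b}_k\in\mathbb{R}^n$, $c_k\in\mathbb{R}$ (no convexity is assumed). The QCQP is: minimize $q_0(\boldsymbol{x})$ over $\boldsymbol{x}\in\mathbb{R}^n$ subject to $q_k(\boldsymbol{x})\le 0$ for $k\in\mathcal{I}$ and $q_k(\boldsymbol{x})=0$ for $k\in\mathcal{E}$. Its feasible set is $\mathcal{F}$. LICQ: a feasible point $\hat{\boldsymbol{x}}\in\mathcal{F}$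 satisfies the LICQ condition if the gradients $\nabla q_k(\hat{\boldsymbol{x}})$, $k\in\{k\in\mathcal{I}\cup\mathcal{E}: q_k(\hat{\boldsymbol{x}})=0\}$, are linearly independent. Penalized SDP: fix an integer $r$ with $2\le r\le n$ and let $\mathcal{C}_r\subseteq\mathbb{S}_n$ be the cone of matrices all of whose $r\times r$ principal submatrices are positive semidefinite. Let $\bar q_k(\boldsymbol{x},\boldsymbol{X})=\langle\boldsymbol{A}_k,\boldsymbol{X}\rangle+2\boldsymbol{b}_k^{\top}\boldsymbol{x}+c_k$. Given $\hat{\boldsymbol{x}}\in\mathbb{R}^n$ and $\eta>0$, the penalized SDP is: minimize $\bar q_0(\boldsymbol{x},\boldsymbol{X})+\eta\,(\mathrm{tr}\{\boldsymbol{X}\}-2\hat{\boldsymbol{x}}^{\top}\boldsymbol{x}+\hat{\boldsymbol{x}}^{\top}\hat{\boldsymbol{x}})$ over $(\boldsymbol{x},\boldsymbol{X})\in\mathbb{R}^n\times\mathbb{S}_n$ subject to $\bar q_k(\boldsymbol{x},\boldsymbol{X})\le0$ for $k\in\mathcal{I}$, $\bar q_k(\boldsymbol{x},\boldsymbol{X})=0$ for $k\in\mathcal{E}$, and $\boldsymbol{X}-\boldsymbol{x}\boldsymbol{x}^{\top}\in\mathcal{C}_r$. "For all sufficiently large $\eta$" means: there is $\eta_0$ such that the assertion holds for every $\eta\ge\eta_0$. *)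

theory Defs
  imports "HOL-Analysis.Analysis"
begin

definition symmetric_matrices :: "(real^'n^'n) set" where
  "symmetric_matrices = {A. transpose A = A}"

definition quad :: "real^'n^'n \<Rightarrow> real^'n \<Rightarrow> real \<Rightarrow> real^'n \<Rightarrow> real" where
  "quad A b c x = x \<bullet> (A *v x) + 2 * (b \<bullet> x) + c"

(* On matrices, the inner product of the library is the Frobenius inner product. *)
definition quad_lift ::
    "real^'n^'n \<Rightarrow> real^'n \<Rightarrow> real \<Rightarrow> real^'n \<Rightarrow> real^'n^'n \<Rightarrow> real" where
  "quad_lift A b c x X = A \<bullet> X + 2 * (b \<bullet> x) + c"

definition gradient :: "('a::real_inner \<Rightarrow> real) \<Rightarrow> 'a \<Rightarrow> 'a" where
  "gradient f x = (THE D. GDERIV f x :> D)"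

definition qcqp_feasible ::
    "'k set \<Rightarrow> 'k set \<Rightarrow> ('k \<Rightarrow> real^'n^'n) \<Rightarrow> ('k \<Rightarrow> real^'n) \<Rightarrow> ('k \<Rightarrow> real) \<Rightarrow> (real^'n) set" where
  "qcqp_feasible I E A b c =
     {x. (\<forall>k\<in>I. quad (A k) (b k) (c k) x \<le> 0) \<and> (\<forall>k\<in>E. quad (A k) (b k) (c k) x = 0)}"

(* Independence of the indexed family of active gradients: independent alone speaks about the
   set of gradients and would not notice two active constraints with the same gradient. *)
definition licq ::
    "'k set \<Rightarrow> 'k set \<Rightarrow> ('k \<Rightarrow> real^'n^'n) \<Rightarrow> ('k \<Rightarrow> real^'n) \<Rightarrow> ('k \<Rightarrow> real) \<Rightarrow> real^'n \<Rightarrow> bool" where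
  "licq I E A b c x =
     (let J = {k \<in> I \<union> E. quad (A k) (b k) (c k) x = 0};
          g = (\<lambda>k. gradient (quad (A k) (b k) (c k)) x)
      in inj_on g J \<and> independent (g ` J))"

(* The principal submatrix of X with row and column set S is positive semidefinite; its symmetry
   is inherited from X where this is used. *)
definition principal_psd :: "'n set \<Rightarrow> real^'n^'n \<Rightarrow> bool" where
  "principal_psd S X = (\<forall>y :: 'n \<Rightarrow> real. 0 \<le> (\<Sum>i\<in>S. \<Sum>j\<in>S. y i * X $ i $ j * y j))"

definition cone_psd :: "nat \<Rightarrow> (real^'n^'n) set" where
  "cone_psd r = {X \<in> symmetric_matrices. \<forall>S. card S = r \<longrightarrow> principal_psd S X}"

definition outer :: "real^'n \<Rightarrow> real^'n^'n" where
  "outer x = (\<chi> i j. x $ i * x $ j)"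

definition pen_feasible ::
    "nat \<Rightarrow> 'k set \<Rightarrow> 'k set \<Rightarrow> ('k \<Rightarrow> real^'n^'n) \<Rightarrow> ('k \<Rightarrow> real^'n) \<Rightarrow> ('k \<Rightarrow> real)
      \<Rightarrow> ((real^'n) \<times> (real^'n^'n)) set" where
  "pen_feasible r I E A b c =
     {(x, X). X \<in> symmetric_matrices \<and>
              (\<forall>k\<in>I. quad_lift (A k) (b k) (c k) x X \<le> 0) \<and>
              (\<forall>k\<in>E. quad_lift (A k) (b k) (c k) x X = 0) \<and>
              X - outer x \<in> cone_psd r}"

definition pen_objective ::
    "real^'n^'n \<Rightarrow> real^'n \<Rightarrow> real \<Rightarrow> real^'n \<Rightarrow> real \<Rightarrow> (real^'n) \<times> (real^'n^'n) \<Rightarrow> real" where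
  "pen_objective A0 b0 c0 xhat \<eta> =
     (\<lambda>(x, X). quad_lift A0 b0 c0 x X + \<eta> * (trace X - 2 * (xhat \<bullet> x) + xhat \<bullet> xhat))"

definition pen_optimal ::
    "nat \<Rightarrow> 'k set \<Rightarrow> 'k set \<Rightarrow> real^'n^'n \<Rightarrow> real^'n \<Rightarrow> real
      \<Rightarrow> ('k \<Rightarrow> real^'n^'n) \<Rightarrow> ('k \<Rightarrow> real^'n) \<Rightarrow> ('k \<Rightarrow> real)
      \<Rightarrow> real^'n \<Rightarrow> real \<Rightarrow> (real^'n) \<times> (real^'n^'n) \<Rightarrow> bool" where
  "pen_optimal r I E A0 b0 c0 A b c xhat \<eta> =
     is_arg_min (pen_objective A0 b0 c0 xhat \<eta>) (\<lambda>z. z \<in> pen_feasible r I E A b c)"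

end

theory Submission
  imports Defs
begin

text \<open>
  Put \<open>H = X - x x\<^sup>T\<close>. Since \<open>r \<ge> 2\<close>, all \<open>2 \<times> 2\<close> principal minors of \<open>H\<close> are nonnegative, so
  \<open>\<parallel>H\<parallel> = O(tr H)\<close>, and the penalised objective is
  \<open>q\<^sub>0(x) + \<langle>A\<^sub>0, H\<rangle> + \<eta> (tr H + \<parallel>x - xhat\<parallel>\<^sup>2)\<close>. For large \<open>\<eta>\<close> its sublevel set at \<open>q\<^sub>0(xhat)\<close> is
  bounded and has \<open>x\<close> close to \<open>xhat\<close>, which gives a minimiser. LICQ provides a local error bound
  for the original constraints, through which every point with \<open>H \<noteq> 0\<close> near \<open>xhat\<close> is beaten by one
  with \<open>H = 0\<close>. Uniqueness follows from convexity: the midpoint of two minimisers \<open>(x, x x\<^sup>T)\<close>,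
  \<open>(y, y y\<^sup>T)\<close> is again a minimiser, but there \<open>H = (x - y)(x - y)\<^sup>T / 4\<close>.
\<close>

section \<open>Quadratic functions, their lifts and their gradients\<close>

lemma inner_matrix_eq_sum:
  fixes A B :: "real^'n^'m"
  shows "A \<bullet> B = (\<Sum>i\<in>UNIV. \<Sum>j\<in>UNIV. A $ i $ j * B $ i $ j)"
  by (simp add: inner_vec_def)

lemma trace_zero: "trace (0 :: real^'n^'n) = 0"
  by (simp add: trace_def)

lemma inner_outer: "A \<bullet> outer x = x \<bullet> (A *v x)"
  unfolding inner_matrix_eq_sum
  by (simp add: outer_def inner_vec_def matrix_vector_mult_def sum_distrib_left mult_ac)

lemma symmetric_inner:
  assumes "A \<in> symmetric_matrices"
  shows "x \<bullet> (A *v y) = y \<bullet> (A *v x)"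
proof -
  have "x \<bullet> (A *v y) = (transpose A *v x) \<bullet> y"
    by (simp only: dot_lmul_matrix transpose_matrix_vector)
  also have "transpose A = A"
    using assms by (simp add: symmetric_matrices_def)
  finally show ?thesis by (simp only: inner_commute)
qed

lemma quad_add:
  assumes "A \<in> symmetric_matrices"
  shows "quad A b c (x + u) = quad A b c x + 2 * ((A *v x + b) \<bullet> u) + u \<bullet> (A *v u)"
  using symmetric_inner[OF assms, of u x] inner_commute[of u "A *v x"]
  by (simp add: quad_def matrix_vector_right_distrib inner_add_left inner_add_right)

lemma continuous_on_quad: "continuous_on S (quad A b c)"
  unfolding quad_def
  by (intro continuous_intros linear_continuous_on matrix_vector_mul_bounded_linear)

text \<open>Isolates the effect of lifting as a perturbation linear in \<open>X - outer x\<close>,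
  which is later bounded by the trace.\<close>

lemma quad_lift_eq: "quad_lift A b c x X = quad A b c x + A \<bullet> (X - outer x)"
  by (simp add: quad_lift_def quad_def inner_diff_right inner_outer)

lemma matrix_vector_bound:
  fixes A :: "real^'n^'m"
  obtains K where "0 < K" "\<And>x. norm (A *v x) \<le> norm x * K"
  using bounded_linear.pos_bounded[OF matrix_vector_mul_bounded_linear[of A]] by blast

lemma matrix_form_bound:
  fixes A :: "real^'n^'m"
  assumes "\<And>x. norm (A *v x) \<le> norm x * K"
  shows "\<bar>x \<bullet> (A *v y)\<bar> \<le> K * norm x * norm y"
proof -
  have "\<bar>x \<bullet> (A *v y)\<bar> \<le> norm x * norm (A *v y)"
    by (rule Cauchy_Schwarz_ineq2)
  also have "\<dots> \<le> norm x * (norm y * K)"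
    by (intro mult_left_mono assms) auto
  finally show ?thesis by (simp add: mult_ac)
qed

lemma gradient_quad:
  fixes A :: "real^'n^'n"
  assumes "A \<in> symmetric_matrices"
  shows "gradient (quad A b c) x = 2 *\<^sub>R (A *v x + b)"
proof -
  have "GDERIV (quad A b c) x :> 2 *\<^sub>R (A *v x + b)"
  proof -
    have "(quad A b c has_derivative (\<lambda>u. x \<bullet> (A *v u) + u \<bullet> (A *v x) + 2 * (b \<bullet> u))) (at x)"
      unfolding quad_def
      by (auto intro!: derivative_eq_intros bounded_linear.has_derivative[OF matrix_vector_mul_bounded_linear])
    moreover have "(\<lambda>u. x \<bullet> (A *v u) + u \<bullet> (A *v x) + 2 * (b \<bullet> u)) = (\<lambda>u. u \<bullet> 2 *\<^sub>R (A *v x + b))"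
      using symmetric_inner[OF assms]
      by (auto simp: fun_eq_iff inner_add_right inner_commute)
    ultimately show ?thesis by (simp add: gderiv_def)
  qed
  \<comment> \<open>\<open>gradient\<close> is a definite description, so uniqueness has to
    accompany existence.\<close>
  moreover have "D = D'" if "GDERIV f x :> D" "GDERIV f x :> D'" for f :: "real^'n \<Rightarrow> real" and D D'
  proof -
    have "(\<lambda>u. u \<bullet> D) = (\<lambda>u. u \<bullet> D')"
      using that has_derivative_unique unfolding gderiv_def by blast
    then show ?thesis by (simp add: fun_eq_iff vector_eq_ldot)
  qed
  ultimately show ?thesis
    unfolding gradient_def by blast
qed

section \<open>The cone of matrices with positive semidefinite principal blocks\<close>

lemma outer_mem_cone_psd: "outer x \<in> cone_psd r"
proof -
  have "(\<Sum>i\<in>S. \<Sum>j\<in>S. y i * outer x $ i $ j * y j) = (\<Sum>i\<in>S. y i * x $ i)\<^sup>2" for S y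
    by (simp add: power2_eq_square sum_product outer_def mult_ac)
  then show ?thesis
    by (auto simp: cone_psd_def principal_psd_def symmetric_matrices_def transpose_def outer_def mult.commute)
qed

lemma cone_psd_scale:
  assumes "X \<in> cone_psd r" "0 \<le> a"
  shows "a *\<^sub>R X \<in> cone_psd r"
proof -
  have "(\<Sum>i\<in>S. \<Sum>j\<in>S. y i * (a *\<^sub>R X) $ i $ j * y j) = a * (\<Sum>i\<in>S. \<Sum>j\<in>S. y i * X $ i $ j * y j)" for S y
    by (simp add: sum_distrib_left mult_ac)
  then show ?thesis
    using assms by (auto simp: cone_psd_def principal_psd_def symmetric_matrices_def transpose_scalar)
qed

text \<open>Pairs of indices control every entry: testing with e_i + s e_j for s = 1 and s = -1
  gives 2 |H_ij| <= H_ii + H_jj, and nonnegative diagonal entries are at most the trace. The factor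
  counts the entries.\<close>

lemma norm_le_trace_cone_psd:
  fixes H :: "real^'n^'n"
  assumes "H \<in> cone_psd r" "2 \<le> r" "r \<le> CARD('n)"
  shows "norm H \<le> (real CARD('n))\<^sup>2 * trace H"
proof -
  have sym: "H $ i $ j = H $ j $ i" for i j
    using assms(1) by (auto simp: cone_psd_def symmetric_matrices_def transpose_def vec_eq_iff)
  have pair: "0 \<le> H $ i $ i + 2 * (s * H $ i $ j) + s\<^sup>2 * H $ j $ j" for i j s
  proof -
    \<comment> \<open>The bounds on \<open>r\<close> let the pair grow to an index set of size
      \<open>r\<close>; the test vector vanishes on the added indices.\<close>
    have "card {i,j} \<le> 2" by (cases "i = j") auto
    then obtain S where S: "{i,j} \<subseteq> S" "card S = r"
      using exists_subset_between[of "{i,j}" r UNIV] assms(2,3) by auto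
    \<comment> \<open>Adding the two contributions, instead of choosing one by cases, also covers i
      = j.\<close>
    define y where "y k = (if k = i then 1 else 0) + (if k = j then s else 0)" for k
    have inner: "(\<Sum>l\<in>S. y k * H $ k $ l * y l) = y k * (H $ k $ i + s * H $ k $ j)" for k
    proof -
      have "(\<Sum>l\<in>S. y k * H $ k $ l * y l)
          = (\<Sum>l\<in>S. (if l = i then y k * H $ k $ l else 0) + (if l = j then s * (y k * H $ k $ l) else 0))"
        by (intro sum.cong) (auto simp: y_def algebra_simps)
      then show ?thesis using S by (simp add: sum.distrib sum.delta algebra_simps)
    qed
    have "(\<Sum>k\<in>S. y k * (H $ k $ i + s * H $ k $ j))
        = (\<Sum>k\<in>S. (if k = i then H $ k $ i + s * H $ k $ j else 0) + (if k = j then s * (H $ k $ i + s * H $ k $ j) else 0))"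
      by (intro sum.cong) (auto simp: y_def algebra_simps)
    also have "\<dots> = H $ i $ i + s * H $ i $ j + s * (H $ j $ i + s * H $ j $ j)"
      using S by (simp add: sum.distrib sum.delta)
    finally have eq: "(\<Sum>k\<in>S. \<Sum>l\<in>S. y k * H $ k $ l * y l) = H $ i $ i + 2 * (s * H $ i $ j) + s\<^sup>2 * H $ j $ j"
      unfolding inner by (simp add: sym[of j i] algebra_simps power2_eq_square)
    have "principal_psd S H"
      using assms(1) S by (simp add: cone_psd_def)
    then have "0 \<le> (\<Sum>k\<in>S. \<Sum>l\<in>S. y k * H $ k $ l * y l)"
      unfolding principal_psd_def by (rule spec)
    then show ?thesis by (simp only: eq)
  qed
  have diag: "0 \<le> H $ i $ i" for i using pair[of i 0] by simp
  have diag_tr: "H $ i $ i \<le> trace H" for i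
    unfolding trace_def by (rule member_le_sum) (auto simp: diag)
  have entry: "\<bar>H $ i $ j\<bar> \<le> trace H" for i j
    using pair[of i 1 j] pair[of i "-1" j] diag_tr[of i] diag_tr[of j] by (simp add: abs_le_iff)
  have "norm H \<le> (\<Sum>i\<in>UNIV. norm (H $ i))"
    unfolding norm_vec_def[of H] by (rule L2_set_le_sum) auto
  also have "\<dots> \<le> (\<Sum>i\<in>(UNIV::'n set). \<Sum>j\<in>(UNIV::'n set). trace H)"
    by (intro sum_mono order_trans[OF norm_le_l1_cart] entry)
  finally show ?thesis by (simp add: power2_eq_square)
qed

section \<open>LICQ and a local error bound\<close>

text \<open>A linear functional may be prescribed on independent vectors, and \<open>w k\<close> is
  its Riesz vector. Injectivity of \<open>g\<close> turns the indicator of the vector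
  \<open>g k\<close> into that of the index \<open>k\<close>. For active gradients, moving along
  \<open>w k\<close> changes only the k-th active constraint to first order.\<close>

lemma licq_dual_basis:
  fixes g :: "'k \<Rightarrow> 'a::euclidean_space"
  assumes "inj_on g J" "independent (g ` J)"
  obtains w where "\<And>j k. j \<in> J \<Longrightarrow> k \<in> J \<Longrightarrow> g j \<bullet> w k = (if j = k then 1 else 0)"
proof -
  have "\<exists>w. \<forall>j\<in>J. g j \<bullet> w = (if j = k then 1 else 0)" if "k \<in> J" for k
  proof -
    obtain f :: "'a \<Rightarrow> real" where f: "linear f" "\<forall>x\<in>g ` J. f x = (if x = g k then 1 else 0)"
      using linear_independent_extend[OF assms(2), of "\<lambda>x. if x = g k then 1 else 0"] by blast
    have "g j \<bullet> adjoint f 1 = (if j = k then 1 else 0)" if "j \<in> J" for j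
      using adjoint_works[OF f(1), of "g j" 1] f(2) that \<open>k \<in> J\<close> assms(1)
      by (auto simp: inj_on_eq_iff)
    then show ?thesis by blast
  qed
  then have "\<exists>w. \<forall>k\<in>J. \<forall>j\<in>J. g j \<bullet> w k = (if j = k then 1 else 0)"
    by (intro bchoice) auto
  then show ?thesis using that by blast
qed

text \<open>The summand of the exact l1 penalty; an index outside \<open>E\<close> counts as an
  inequality.\<close>

definition violation :: "'k set \<Rightarrow> 'k \<Rightarrow> real \<Rightarrow> real" where
  "violation E k t = (if k \<in> E then \<bar>t\<bar> else max 0 t)"

lemma violation_nonneg: "0 \<le> violation E k t"
  by (simp add: violation_def)

lemma violation_lipschitz: "violation E k s \<le> violation E k t + \<bar>s - t\<bar>"
  by (auto simp: violation_def)

text \<open>A positive violation means a positive value, or a negative value of an equality. In both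
  cases the shift \<open>- \<tau> * sgn t\<close> moves the value towards 0, and
  \<open>\<tau> \<le> \<bar>t\<bar>\<close> prevents overshooting.\<close>

lemma violation_descent:
  assumes "0 < violation E k t" "0 \<le> \<tau>" "\<tau> \<le> \<bar>t\<bar>" "\<bar>s - t + \<tau> * sgn t\<bar> \<le> e"
  shows "violation E k s \<le> violation E k t - \<tau> + e"
proof (cases "0 < t")
  case True
  then have "\<bar>s - t + \<tau>\<bar> \<le> e" "\<tau> \<le> t" using assms(3,4) by simp_all
  then have "\<bar>s\<bar> \<le> t - \<tau> + e" by linarith
  then show ?thesis using True by (auto simp: violation_def)
next
  case False
  then have "k \<in> E" "t < 0" using assms(1) by (auto simp: violation_def split: if_splits)
  then have "\<bar>s - t - \<tau>\<bar> \<le> e" "\<tau> \<le> - t" using assms(3,4) by simp_all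
  then have "\<bar>s\<bar> \<le> - t - \<tau> + e" by linarith
  then show ?thesis using \<open>k \<in> E\<close> \<open>t < 0\<close> by (simp add: violation_def)
qed


text \<open>A step along the dual vector of a violated constraint gains \<tau> there. The errors
  over all of \<open>J\<close> cost at most \<tau>/2 and the length term at most \<tau>/4, so a
  strict decrease remains.\<close>

lemma sum_violation_descent:
  fixes A :: "'k \<Rightarrow> real^'n^'n"
    and b :: "'k \<Rightarrow> real^'n" and c :: "'k \<Rightarrow> real"
    and xhat :: "real^'n" and E J :: "'k set"
  defines "q \<equiv> \<lambda>j. quad (A j) (b j) (c j)"
  defines "v \<equiv> \<lambda>x. \<Sum>j\<in>J. violation E j (q j x)"
  assumes fin: "finite J"
    and sym: "\<And>j. j \<in> J \<Longrightarrow> A j \<in> symmetric_matrices"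
    and dual: "\<And>j k. j \<in> J \<Longrightarrow> k \<in> J \<Longrightarrow> (2 *\<^sub>R (A j *v xhat + b j)) \<bullet> w k = (if j = k then 1 else 0)"
    and M: "0 < M" "\<And>j x. j \<in> J \<Longrightarrow> norm (A j *v x) \<le> norm x * M"
    and D: "0 < D" "\<And>k. k \<in> J \<Longrightarrow> norm (w k) \<le> D"
    and \<rho>: "norm (z - xhat) \<le> \<rho>" "8 * real (card J) * M * D * \<rho> \<le> 1"
    and \<beta>: "0 < \<beta>" and pos: "0 < v z"
  shows "\<exists>u. norm u \<le> \<beta> \<and> v (z + u) + norm u / (4 * D) < v z"
proof -
  obtain k where k: "k \<in> J" "0 < violation E k (q k z)"
    using pos sum_nonpos[of J "\<lambda>j. violation E j (q j z)"] unfolding v_def by (meson not_le)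
  have N: "0 < real (card J)" using k fin by (auto simp: card_gt_0_iff)
  have qk: "0 < \<bar>q k z\<bar>" using k(2) by (auto simp: violation_def split: if_splits)
  \<comment> \<open>The three caps prevent overshooting, keep the step within length \<beta>, and
    bound the total second-order error by \<tau>/4.\<close>
  define \<tau> where "\<tau> = min (min \<bar>q k z\<bar> (\<beta> / D)) (1 / (4 * real (card J) * M * D\<^sup>2))"
  have \<tau>: "0 < \<tau>" "\<tau> \<le> \<bar>q k z\<bar>" using qk \<beta> N M(1) D(1) by (auto simp: \<tau>_def)
  have "\<tau> \<le> \<beta> / D" by (auto simp: \<tau>_def)
  then have \<tau>D: "\<tau> * D \<le> \<beta>" using D(1) by (simp add: field_simps)
  have "\<tau> \<le> 1 / (4 * real (card J) * M * D\<^sup>2)" by (auto simp: \<tau>_def)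
  then have \<tau>N: "4 * real (card J) * M * D\<^sup>2 * \<tau> \<le> 1" using D(1) M(1) N by (simp add: field_simps)
  define u where "u = (- \<tau> * sgn (q k z)) *\<^sub>R w k"
  have "norm u \<le> \<tau> * norm (w k)" using \<tau> by (simp add: u_def abs_mult sgn_if)
  also have "\<dots> \<le> \<tau> * D" using \<tau> D(2)[OF k(1)] by simp
  finally have u: "norm u \<le> \<tau> * D" .
  \<comment> \<open>The first term accounts for the gradient at \<open>z\<close> differing from the
    one at \<open>xhat\<close>, the second for the curvature along the step.\<close>
  define e where "e = 2 * (M * \<rho> * (\<tau> * D)) + M * (\<tau> * D) * (\<tau> * D)"
  have step: "\<bar>q j (z + u) - q j z + (if j = k then \<tau> * sgn (q k z) else 0)\<bar> \<le> e" if j: "j \<in> J" for j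
  proof -
    \<comment> \<open>Duality holds for the gradients at \<open>xhat\<close>, so the expansion at
      \<open>z\<close> is referred back to \<open>xhat\<close>.\<close>
    have lin: "2 * ((A j *v xhat + b j) \<bullet> u) = - (if j = k then \<tau> * sgn (q k z) else 0)"
      using dual[OF j k(1)] by (cases "j = k") (auto simp: u_def)
    have "q j (z + u) - q j z = 2 * ((A j *v z + b j) \<bullet> u) + u \<bullet> (A j *v u)"
      unfolding q_def using quad_add[OF sym[OF j]] by simp
    also have "(A j *v z + b j) \<bullet> u = (A j *v xhat + b j) \<bullet> u + u \<bullet> (A j *v (z - xhat))"
      by (simp add: matrix_vector_mult_diff_distrib inner_add_right inner_diff_right inner_commute[of _ u])
    finally have "q j (z + u) - q j z + (if j = k then \<tau> * sgn (q k z) else 0)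
        = 2 * (u \<bullet> (A j *v (z - xhat))) + u \<bullet> (A j *v u)"
      using lin by simp
    moreover have "\<bar>u \<bullet> (A j *v (z - xhat))\<bar> \<le> M * \<rho> * (\<tau> * D)"
    proof -
      have "\<bar>u \<bullet> (A j *v (z - xhat))\<bar> \<le> M * norm u * norm (z - xhat)"
        by (rule matrix_form_bound[OF M(2)[OF j]])
      also have "\<dots> \<le> M * (\<tau> * D) * \<rho>"
        using u \<rho>(1) M(1) \<tau>(1) D(1) by (intro mult_mono) auto
      finally show ?thesis by (simp add: mult_ac)
    qed
    moreover have "\<bar>u \<bullet> (A j *v u)\<bar> \<le> M * (\<tau> * D) * (\<tau> * D)"
    proof -
      have "\<bar>u \<bullet> (A j *v u)\<bar> \<le> M * norm u * norm u"
        by (rule matrix_form_bound[OF M(2)[OF j]])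
      also have "\<dots> \<le> M * (\<tau> * D) * (\<tau> * D)"
        using u M(1) \<tau>(1) D(1) by (intro mult_mono) auto
      finally show ?thesis .
    qed
    ultimately show ?thesis unfolding e_def by linarith
  qed
  have "violation E j (q j (z + u)) \<le> violation E j (q j z) + e - (if j = k then \<tau> else 0)" if j: "j \<in> J" for j
  proof (cases "j = k")
    case True
    then have "violation E k (q k (z + u)) \<le> violation E k (q k z) - \<tau> + e"
      using k(2) \<tau> step[OF k(1)] by (intro violation_descent) auto
    then show ?thesis using True by simp
  next
    case False
    then show ?thesis using step[OF j] violation_lipschitz[of E j "q j (z + u)" "q j z"] by simp
  qed
  then have "v (z + u) \<le> (\<Sum>j\<in>J. violation E j (q j z) + e - (if j = k then \<tau> else 0))"
    unfolding v_def by (intro sum_mono)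
  also have "\<dots> = v z + card J * e - \<tau>"
    using fin k(1) by (simp add: v_def sum.distrib sum_subtractf)
  finally have *: "v (z + u) \<le> v z + card J * e - \<tau>" .
  \<comment> \<open>Each factor in parentheses is at most 1, by the smallness of \<rho> and of
    \<tau> respectively.\<close>
  have "card J * e = \<tau> / 4 * (8 * real (card J) * M * D * \<rho>) + \<tau> / 4 * (4 * real (card J) * M * D\<^sup>2 * \<tau>)"
    by (simp add: e_def power2_eq_square algebra_simps)
  also have "\<dots> \<le> \<tau> / 4 * 1 + \<tau> / 4 * 1"
    using \<rho>(2) \<tau>N \<tau>(1) by (intro add_mono mult_left_mono) auto
  finally have "v (z + u) \<le> v z - \<tau> / 2" using * by simp
  moreover have "norm u / (4 * D) \<le> \<tau> / 4" using u D(1) by (simp add: field_simps)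
  ultimately have "v (z + u) + norm u / (4 * D) < v z" using \<tau>(1) by simp
  then show ?thesis using u \<tau>D by (intro exI[of _ u]) auto
qed

text \<open>Minimising the violation plus a small multiple of the distance to \<open>x\<close> yields a
  feasible point at distance controlled by the violation, because an infeasible minimiser
  could be improved along a vector of the dual basis.\<close>

lemma quad_error_bound:
  fixes A :: "'k \<Rightarrow> real^'n^'n"
    and b :: "'k \<Rightarrow> real^'n" and c :: "'k \<Rightarrow> real"
    and xhat :: "real^'n" and E J :: "'k set"
  defines "q \<equiv> \<lambda>j. quad (A j) (b j) (c j)"
  defines "v \<equiv> \<lambda>x. \<Sum>j\<in>J. violation E j (q j x)"
  assumes fin: "finite J"
    and sym: "\<And>j. j \<in> J \<Longrightarrow> A j \<in> symmetric_matrices"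
    and dual: "\<And>j k. j \<in> J \<Longrightarrow> k \<in> J \<Longrightarrow> (2 *\<^sub>R (A j *v xhat + b j)) \<bullet> w k = (if j = k then 1 else 0)"
    and active: "\<And>j. j \<in> J \<Longrightarrow> q j xhat = 0"
  shows "\<exists>\<kappa>>0. \<exists>\<rho>0>0. \<forall>\<rho>. 0 < \<rho> \<and> \<rho> \<le> \<rho>0 \<longrightarrow>
    (\<exists>\<delta>>0. \<forall>x\<in>cball xhat \<delta>. \<exists>z\<in>cball xhat \<rho>. v z = 0 \<and> norm (z - x) \<le> \<kappa> * v x)"
proof -
  have "\<forall>j. \<exists>K. 0 < K \<and> (\<forall>x. norm (A j *v x) \<le> norm x * K)"
    using matrix_vector_bound by meson
  then obtain K where K: "\<And>j. 0 < K j" "\<And>j x. norm (A j *v x) \<le> norm x * K j"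
    by metis
  \<comment> \<open>The leading 1, here and in \<open>D\<close>, keeps the constant positive when
    \<open>J\<close> is empty.\<close>
  define M where "M = 1 + (\<Sum>j\<in>J. K j)"
  have M0: "0 < M" unfolding M_def by (intro add_pos_nonneg sum_nonneg) (auto intro: less_imp_le K)
  have M: "norm (A j *v x) \<le> norm x * M" if "j \<in> J" for j x
  proof -
    have "K j \<le> M" unfolding M_def
      using member_le_sum[OF that, of K] fin K(1) by (smt (verit, best))
    then show ?thesis using K(2)[of j x] by (meson mult_left_mono norm_ge_zero order_trans)
  qed
  define D where "D = 1 + (\<Sum>k\<in>J. norm (w k))"
  have D0: "0 < D" unfolding D_def by (intro add_pos_nonneg sum_nonneg) auto
  have D: "norm (w k) \<le> D" if "k \<in> J" for k
    unfolding D_def using member_le_sum[OF that, of "\<lambda>k. norm (w k)"] fin by simp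
  \<comment> \<open>The largest radius allowed by the descent step, with \<open>card J + 1\<close>
    to avoid dividing by zero.\<close>
  define \<rho>0 where "\<rho>0 = 1 / (8 * real (card J + 1) * M * D)"
  have \<rho>0: "0 < \<rho>0" using M0 D0 by (simp add: \<rho>0_def)
  have cont_q: "continuous_on S (q j)" for S j
    unfolding q_def by (rule continuous_on_quad)
  have cont_v: "continuous_on S v" for S
  proof -
    have "continuous_on S (\<lambda>x. violation E j (q j x))" for j
      unfolding violation_def by (cases "j \<in> E") (auto intro!: continuous_intros cont_q)
    then show ?thesis unfolding v_def by (intro continuous_on_sum)
  qed
  have v_nonneg: "0 \<le> v x" for x unfolding v_def by (intro sum_nonneg violation_nonneg)
  have v_xhat: "v xhat = 0" unfolding v_def by (intro sum.neutral) (simp add: active violation_def)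
  have "\<exists>\<delta>>0. \<forall>x\<in>cball xhat \<delta>. \<exists>z\<in>cball xhat \<rho>. v z = 0 \<and> norm (z - x) \<le> (4 * D) * v x"
    if \<rho>: "0 < \<rho>" "\<rho> \<le> \<rho>0" for \<rho>
  proof -
    have small: "8 * real (card J) * M * D * \<rho> \<le> 1"
    proof -
      have "8 * real (card J) * M * D * \<rho> \<le> 8 * real (card J + 1) * M * D * \<rho>0"
        using \<rho> M0 D0 by (intro mult_mono) auto
      also have "\<dots> = 1" using M0 D0 by (simp add: \<rho>0_def)
      finally show ?thesis .
    qed
    have "isCont v xhat" using cont_v[of UNIV] by (simp add: continuous_on_eq_continuous_at)
    \<comment> \<open>The threshold is chosen so that \<open>4 * D\<close> times the violation is
      below \<rho>/4, which puts the later minimiser strictly inside the ball of radius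
      \<rho>.\<close>
    then have "\<exists>d>0. \<forall>x. dist x xhat < d \<longrightarrow> dist (v x) (v xhat) < \<rho> / (16 * D)"
      using \<rho>(1) D0 unfolding continuous_at_eps_delta by simp
    then obtain d where d: "0 < d" "\<And>x. dist x xhat < d \<Longrightarrow> v x < \<rho> / (16 * D)"
      using v_xhat v_nonneg by (auto simp: dist_real_def)
    define \<delta> where "\<delta> = min (d / 2) (\<rho> / 2)"
    have "\<exists>z\<in>cball xhat \<rho>. v z = 0 \<and> norm (z - x) \<le> (4 * D) * v x" if x: "x \<in> cball xhat \<delta>" for x
    proof -
      have vx: "v x < \<rho> / (16 * D)" using x d by (auto simp: \<delta>_def dist_commute)
      have xr: "norm (x - xhat) \<le> \<rho> / 2" using x by (auto simp: \<delta>_def dist_norm norm_minus_commute)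
      \<comment> \<open>The weight \<open>1 / (4 * D)\<close> is the rate at which the descent step
        pays for its length.\<close>
      define \<psi> where "\<psi> z = v z + norm (z - x) / (4 * D)" for z
      have "\<exists>z\<in>cball xhat \<rho>. \<forall>y\<in>cball xhat \<rho>. \<psi> z \<le> \<psi> y"
        unfolding \<psi>_def using \<rho>(1) D0
        by (intro continuous_attains_inf) (auto intro!: continuous_intros cont_v)
      then obtain z where z: "z \<in> cball xhat \<rho>" "\<And>y. y \<in> cball xhat \<rho> \<Longrightarrow> \<psi> z \<le> \<psi> y" by blast
      have "x \<in> cball xhat \<rho>" using xr \<rho>(1) by (simp add: dist_norm norm_minus_commute)
      then have zx: "v z + norm (z - x) / (4 * D) \<le> v x" using z(2)[of x] by (simp add: \<psi>_def)
      then have near: "norm (z - x) \<le> 4 * D * v x"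
        using v_nonneg[of z] D0 by (simp add: field_simps) (smt (verit) mult_nonneg_nonneg)
      also have "\<dots> < 4 * D * (\<rho> / (16 * D))" using vx D0 by (intro mult_strict_left_mono) auto
      also have "\<dots> = \<rho> / 4" using D0 by simp
      finally have "norm (z - xhat) < \<rho>"
        using xr \<rho>(1) norm_triangle_ineq[of "z - x" "x - xhat"] by simp
      \<comment> \<open>This slack is the step length that keeps the improved point in the
        ball.\<close>
      then have \<beta>: "0 < \<rho> - norm (z - xhat)" by simp
      have "v z = 0"
      proof (rule ccontr)
        assume "v z \<noteq> 0"
        then have "0 < v z" using v_nonneg[of z] by simp
        then obtain u where u: "norm u \<le> \<rho> - norm (z - xhat)" "v (z + u) + norm u / (4 * D) < v z"
          using sum_violation_descent[OF fin sym dual M0 M D0 D, of z \<rho> "\<rho> - norm (z - xhat)" E c] \<beta> small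
          unfolding v_def q_def by auto
        have "z + u \<in> cball xhat \<rho>"
          using u(1) norm_triangle_ineq[of "z - xhat" u]
          by (simp add: dist_norm norm_minus_commute algebra_simps)
        then have "v z + norm (z - x) / (4 * D) \<le> v (z + u) + norm (z + u - x) / (4 * D)"
          using z(2)[of "z + u"] by (simp add: \<psi>_def)
        moreover have "norm (z + u - x) / (4 * D) \<le> norm (z - x) / (4 * D) + norm u / (4 * D)"
          using norm_triangle_ineq[of "z - x" u] D0 by (simp add: algebra_simps flip: add_divide_distrib)
            (intro divide_right_mono, auto)
        ultimately show False using u(2) by linarith
      qed
      then show ?thesis using z(1) near by blast
    qed
    moreover have "0 < \<delta>" using d(1) \<rho>(1) by (simp add: \<delta>_def)
    ultimately show ?thesis by blast
  qed
  \<comment> \<open>The constant \<open>4 * D\<close> is fixed before \<rho>, so \<rho> may later be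
    chosen in terms of it.\<close>
  then show ?thesis using D0 \<rho>0
    by (intro exI[of _ "4 * D"] conjI exI[of _ \<rho>0]) auto
qed


section \<open>The penalized problem in terms of \<open>X - outer x\<close>\<close>

text \<open>Since the trace of \<open>outer x\<close> is the squared norm of \<open>x\<close>,
  completing the square turns the linear penalty into a trace plus a proximal term.\<close>

lemma pen_objective_eq:
  "pen_objective A0 b0 c0 xhat \<eta> (x, X) =
    quad A0 b0 c0 x + A0 \<bullet> (X - outer x) + \<eta> * (trace (X - outer x) + (norm (x - xhat))\<^sup>2)"
proof -
  have "trace (outer x) = x \<bullet> x"
    by (simp add: trace_def outer_def inner_vec_def)
  then have "trace X - 2 * (xhat \<bullet> x) + xhat \<bullet> xhat = trace (X - outer x) + (norm (x - xhat))\<^sup>2"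
    by (simp add: trace_sub power2_norm_eq_inner inner_diff_left inner_diff_right inner_commute[of x xhat])
  then show ?thesis by (simp add: pen_objective_def quad_lift_eq)
qed

lemma pen_feasible_iff:
  "(x, X) \<in> pen_feasible r I E A b c \<longleftrightarrow>
    (\<forall>k\<in>I. quad (A k) (b k) (c k) x + A k \<bullet> (X - outer x) \<le> 0) \<and>
    (\<forall>k\<in>E. quad (A k) (b k) (c k) x + A k \<bullet> (X - outer x) = 0) \<and>
    X - outer x \<in> cone_psd r"
proof -
  have "X \<in> symmetric_matrices" if "X - outer x \<in> cone_psd r"
  proof -
    have "(X - outer x) $ i $ j = (X - outer x) $ j $ i" for i j
      using that by (simp add: cone_psd_def symmetric_matrices_def transpose_def vec_eq_iff)
    then show ?thesis
      by (simp add: symmetric_matrices_def transpose_def outer_def vec_eq_iff mult.commute)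
  qed
  then show ?thesis by (auto simp: pen_feasible_def quad_lift_eq)
qed

lemma outer_pen_feasible_iff:
  fixes x :: "real^'n"
  shows "(x, outer x) \<in> pen_feasible r I E A b c \<longleftrightarrow> x \<in> qcqp_feasible I E A b c"
proof -
  have "outer 0 = (0 :: real^'n^'n)" by (simp add: outer_def vec_eq_iff)
  then have "(0 :: real^'n^'n) \<in> cone_psd r" using outer_mem_cone_psd[of "0 :: real^'n" r] by simp
  then show ?thesis by (simp add: pen_feasible_iff qcqp_feasible_def)
qed

lemma outer_eq_0_iff: "outer x = 0 \<longleftrightarrow> x = 0"
  by (auto simp: outer_def vec_eq_iff)

lemma norm_outer: "norm (outer x) = (norm x)\<^sup>2"
proof -
  have "outer x \<bullet> outer x = (x \<bullet> x) * (x \<bullet> x)"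
    unfolding inner_matrix_eq_sum by (simp add: outer_def inner_vec_def sum_product mult_ac)
  then have "(norm (outer x))\<^sup>2 = ((norm x)\<^sup>2)\<^sup>2"
    by (simp only: power2_norm_eq_inner power2_eq_square[of "x \<bullet> x"])
  then show ?thesis by (simp only: power2_eq_iff_nonneg norm_ge_zero zero_le_power2)
qed

lemma continuous_on_outer: "continuous_on S outer"
  unfolding outer_def by (intro continuous_intros continuous_on_vec_lambda)

lemma closed_cone_psd: "closed (cone_psd r :: (real^'n^'n) set)"
proof -
  have "closed {X :: real^'n^'n. transpose X = X}"
    unfolding transpose_def
    by (intro closed_Collect_eq continuous_intros continuous_on_vec_lambda)
  moreover have "closed {X :: real^'n^'n. \<forall>S. card S = r \<longrightarrow> (\<forall>y. 0 \<le> (\<Sum>i\<in>S. \<Sum>j\<in>S. y i * X $ i $ j * y j))}"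
    by (intro closed_Collect_all closed_Collect_imp open_Collect_const closed_Collect_le continuous_intros)
  ultimately show ?thesis
    unfolding cone_psd_def symmetric_matrices_def principal_psd_def
    by (simp add: Collect_conj_eq closed_Int)
qed

lemma closed_pen_feasible: "closed (pen_feasible r I E A b c)"
proof -
  have [continuous_intros]: "continuous_on S f \<Longrightarrow> continuous_on S (\<lambda>z. outer (f z))"
    for S :: "'z::topological_space set" and f :: "'z \<Rightarrow> real^'m"
    using continuous_on_compose2[OF continuous_on_outer[of UNIV]] by blast
  have [continuous_intros]: "continuous_on S f \<Longrightarrow> continuous_on S (\<lambda>z. quad P p t (f z))"
    for S :: "'z::topological_space set" and f :: "'z \<Rightarrow> real^'m" and P p t
    using continuous_on_compose2[OF continuous_on_quad[of UNIV]] by blast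
  \<comment> \<open>Every condition becomes a closed one on a continuous function of the pair, the
    cone condition being a preimage.\<close>
  have "pen_feasible r I E A b c = {z.
    (\<forall>k\<in>I. quad (A k) (b k) (c k) (fst z) + A k \<bullet> (snd z - outer (fst z)) \<le> 0) \<and>
    (\<forall>k\<in>E. quad (A k) (b k) (c k) (fst z) + A k \<bullet> (snd z - outer (fst z)) = 0) \<and>
    z \<in> (\<lambda>z. snd z - outer (fst z)) -` cone_psd r}"
    by (auto simp: pen_feasible_iff)
  also have "closed \<dots>"
    unfolding Ball_def
    by (intro closed_Collect_conj closed_Collect_all closed_Collect_imp open_Collect_const
        closed_Collect_le closed_Collect_eq continuous_intros)
      (simp_all only: Collect_mem_eq closed_vimage[OF closed_cone_psd] continuous_intros)
  finally show ?thesis .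
qed

text \<open>Prices the repair of a point near \<open>xhat\<close> in terms of the distance
  moved.\<close>

lemma quad_lipschitz:
  fixes A :: "real^'n^'n"
  assumes "A \<in> symmetric_matrices"
  obtains L where "0 < L"
    "\<And>x y. x \<in> cball a 1 \<Longrightarrow> y \<in> cball a 1 \<Longrightarrow> \<bar>quad A b c y - quad A b c x\<bar> \<le> L * norm (y - x)"
proof -
  obtain K where K: "0 < K" "\<And>x. norm (A *v x) \<le> norm x * K"
    using matrix_vector_bound[of A] by blast
  define R where "R = norm a + 1"
  have "\<bar>quad A b c y - quad A b c x\<bar> \<le> (2 * (R * K + norm b) + 2 * K + 1) * norm (y - x)"
    if x: "x \<in> cball a 1" and y: "y \<in> cball a 1" for x y
  proof -
    have nx: "norm x \<le> R" using x norm_triangle_ineq[of a "x - a"]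
      by (simp add: R_def dist_norm norm_minus_commute)
    have nyx: "norm (y - x) \<le> 2"
      using x y dist_triangle[of y x a] by (simp add: dist_norm norm_minus_commute)
    have "quad A b c y - quad A b c x = 2 * ((A *v x + b) \<bullet> (y - x)) + (y - x) \<bullet> (A *v (y - x))"
      using quad_add[OF assms, of b c x "y - x"] by simp
    moreover have "\<bar>(A *v x + b) \<bullet> (y - x)\<bar> \<le> (R * K + norm b) * norm (y - x)"
    proof -
      have "norm (A *v x + b) \<le> R * K + norm b"
        using norm_triangle_ineq[of "A *v x" b] K(2)[of x] mult_right_mono[OF nx, of K] K(1) by linarith
      then show ?thesis
        by (intro order_trans[OF Cauchy_Schwarz_ineq2] mult_right_mono) auto
    qed
    moreover have "\<bar>(y - x) \<bullet> (A *v (y - x))\<bar> \<le> 2 * K * norm (y - x)"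
    proof -
      have "\<bar>(y - x) \<bullet> (A *v (y - x))\<bar> \<le> K * norm (y - x) * norm (y - x)"
        by (rule matrix_form_bound[OF K(2)])
      also have "\<dots> \<le> K * 2 * norm (y - x)"
        using nyx K(1) by (intro mult_right_mono mult_left_mono) auto
      finally show ?thesis by (simp add: mult_ac)
    qed
    ultimately have "\<bar>quad A b c y - quad A b c x\<bar> \<le> 2 * ((R * K + norm b) * norm (y - x)) + 2 * K * norm (y - x)"
      by linarith
    then show ?thesis by (simp add: algebra_simps)
      (smt (verit) norm_ge_zero)
  qed
  moreover have "0 < 2 * (R * K + norm b) + 2 * K + 1"
    using K(1) by (auto simp: R_def intro!: add_nonneg_pos add_nonneg_nonneg)
  ultimately show ?thesis using that by blast
qed

text \<open>Unlike the Lipschitz bound this is global: without convexity the function can still fall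
  at most quadratically, which a large \<eta> absorbs.\<close>

lemma quad_lower_bound:
  fixes A :: "real^'n^'n"
  assumes "A \<in> symmetric_matrices"
  obtains L where "0 < L"
    "\<And>x. quad A b c a - L * norm (x - a) - L * (norm (x - a))\<^sup>2 \<le> quad A b c x"
proof -
  obtain K where K: "0 < K" "\<And>x. norm (A *v x) \<le> norm x * K"
    using matrix_vector_bound[of A] by blast
  define L where "L = 2 * norm (A *v a + b) + K"
  have "quad A b c a - L * norm (x - a) - L * (norm (x - a))\<^sup>2 \<le> quad A b c x" for x
  proof -
    have "quad A b c x = quad A b c a + 2 * ((A *v a + b) \<bullet> (x - a)) + (x - a) \<bullet> (A *v (x - a))"
      using quad_add[OF assms, of b c a "x - a"] by simp
    moreover have "\<bar>(A *v a + b) \<bullet> (x - a)\<bar> \<le> norm (A *v a + b) * norm (x - a)"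
      by (rule Cauchy_Schwarz_ineq2)
    moreover have "\<bar>(x - a) \<bullet> (A *v (x - a))\<bar> \<le> K * norm (x - a) * norm (x - a)"
      by (rule matrix_form_bound[OF K(2)])
    moreover have "L * norm (x - a) = 2 * (norm (A *v a + b) * norm (x - a)) + K * norm (x - a)"
      "L * (norm (x - a))\<^sup>2 = 2 * norm (A *v a + b) * (norm (x - a))\<^sup>2 + K * norm (x - a) * norm (x - a)"
      by (simp_all add: L_def algebra_simps power2_eq_square)
    moreover have "0 \<le> 2 * norm (A *v a + b) * (norm (x - a))\<^sup>2" "0 \<le> K * norm (x - a)"
      using K(1) by auto
    ultimately show ?thesis by linarith
  qed
  moreover have "0 < L" using K(1) by (simp add: L_def add_nonneg_pos)
  ultimately show ?thesis using that by blast
qed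

section \<open>Midpoints of rank-one points\<close>

lemma outer_midpoint:
  "(1/2) *\<^sub>R (outer x + outer y) - outer ((1/2) *\<^sub>R (x + y)) = (1/4) *\<^sub>R outer (x - y)"
  by (simp add: outer_def vec_eq_iff field_simps)

lemma quad_lift_midpoint:
  "quad_lift A b c ((1/2) *\<^sub>R (x + y)) ((1/2) *\<^sub>R (X + Y)) = (quad_lift A b c x X + quad_lift A b c y Y) / 2"
  by (simp add: quad_lift_def inner_add_right field_simps)

text \<open>The lifted constraints are affine in the pair, and the midpoint leaves the cone defect
  \<open>(1/4) *\<^sub>R outer (x - y)\<close>, which lies in the cone.\<close>

lemma pen_feasible_midpoint:
  assumes "(x, outer x) \<in> pen_feasible r I E A b c" "(y, outer y) \<in> pen_feasible r I E A b c"
  shows "((1/2) *\<^sub>R (x + y), (1/2) *\<^sub>R (outer x + outer y)) \<in> pen_feasible r I E A b c"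
  using assms cone_psd_scale[OF outer_mem_cone_psd, of "1/4" "x - y" r]
  unfolding pen_feasible_iff outer_midpoint[symmetric] quad_lift_eq[symmetric] quad_lift_midpoint
  by (auto simp: add_nonpos_nonpos)

lemma pen_objective_midpoint:
  "pen_objective A b c xhat \<eta> ((1/2) *\<^sub>R (x + y), (1/2) *\<^sub>R (X + Y)) =
    (pen_objective A b c xhat \<eta> (x, X) + pen_objective A b c xhat \<eta> (y, Y)) / 2"
  unfolding pen_objective_def prod.case quad_lift_midpoint
  by (simp add: trace_def sum.distrib inner_add_right field_simps flip: sum_divide_distrib)


section \<open>Trace estimates and localisation of sublevel sets\<close>

lemma inner_cone_psd_bound:
  fixes H :: "real^'n^'n"
  assumes "H \<in> cone_psd r" "2 \<le> r" "r \<le> CARD('n)"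
  shows "\<bar>P \<bullet> H\<bar> \<le> norm P * (real CARD('n))\<^sup>2 * trace H"
proof -
  have "\<bar>P \<bullet> H\<bar> \<le> norm P * norm H" by (rule Cauchy_Schwarz_ineq2)
  also have "\<dots> \<le> norm P * ((real CARD('n))\<^sup>2 * trace H)"
    by (intro mult_left_mono norm_le_trace_cone_psd[OF assms]) auto
  finally show ?thesis by (simp add: mult.assoc)
qed

lemma trace_cone_psd_pos:
  fixes H :: "real^'n^'n"
  assumes "H \<in> cone_psd r" "2 \<le> r" "r \<le> CARD('n)"
  shows "0 \<le> trace H" and "H \<noteq> 0 \<Longrightarrow> 0 < trace H"
proof -
  have *: "norm H \<le> (real CARD('n))\<^sup>2 * trace H" by (rule norm_le_trace_cone_psd[OF assms])
  have "0 \<le> (real CARD('n))\<^sup>2 * trace H" using * norm_ge_zero[of H] by linarith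
  then show "0 \<le> trace H" by (simp add: zero_le_mult_iff)
  assume "H \<noteq> 0"
  then have "0 < (real CARD('n))\<^sup>2 * trace H" using * zero_less_norm_iff[of H] by linarith
  then show "0 < trace H" by (simp add: zero_less_mult_iff)
qed

text \<open>With t the distance to \<open>xhat\<close>, the sublevel condition becomes
  \<open>(\<eta> - C) * trace H + (\<eta> - L) * t\<^sup>2 \<le> L * t\<close>. Dropping the trace
  term bounds t, and dropping the square then bounds the trace, by a constant independent of
  \<eta>.\<close>

lemma pen_sublevel_localised:
  fixes A0 :: "real^'n^'n" and xhat :: "real^'n"
  assumes "A0 \<in> symmetric_matrices" "2 \<le> r" "r \<le> CARD('n)" "0 < \<delta>"
  shows "\<exists>\<eta>1 R. \<forall>\<eta>\<ge>\<eta>1. \<forall>(x, X)\<in>pen_feasible r I E A b c.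
    pen_objective A0 b0 c0 xhat \<eta> (x, X) \<le> quad A0 b0 c0 xhat \<longrightarrow>
      norm (x - xhat) \<le> \<delta> \<and> norm X \<le> R"
proof -
  obtain L where L: "0 < L"
    "\<And>x. quad A0 b0 c0 xhat - L * norm (x - xhat) - L * (norm (x - xhat))\<^sup>2 \<le> quad A0 b0 c0 x"
    using quad_lower_bound[OF assms(1), of b0 c0 xhat] by blast
  define N where "N = (real CARD('n))\<^sup>2"
  define C where "C = norm A0 * N"
  \<comment> \<open>\<open>C\<close> absorbs \<open>A0 \<bullet> H\<close>, \<open>L\<close> absorbs
    the quadratic fall of the objective, \<open>L / \<delta>\<close> forces t below \<delta>, and 1
    gives a margin in both coefficients.\<close>
  define \<eta>1 where "\<eta>1 = C + L + L / \<delta> + 1"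
  define R where "R = N * (L * \<delta>) + (norm xhat + \<delta>)\<^sup>2"
  have C0: "0 \<le> C" by (simp add: C_def N_def)
  have "norm (x - xhat) \<le> \<delta> \<and> norm X \<le> R"
    if \<eta>: "\<eta>1 \<le> \<eta>" and feas: "(x, X) \<in> pen_feasible r I E A b c"
      and le: "pen_objective A0 b0 c0 xhat \<eta> (x, X) \<le> quad A0 b0 c0 xhat" for \<eta> x X
  proof -
    define H where "H = X - outer x"
    define t where "t = norm (x - xhat)"
    have H: "H \<in> cone_psd r" using feas by (simp add: pen_feasible_iff H_def)
    have tr: "0 \<le> trace H" using trace_cone_psd_pos(1)[OF H assms(2,3)] .
    have "\<bar>A0 \<bullet> H\<bar> \<le> C * trace H"
      unfolding C_def N_def by (rule inner_cone_psd_bound[OF H assms(2,3)])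
    moreover have "quad A0 b0 c0 x + A0 \<bullet> H + \<eta> * (trace H + t\<^sup>2) \<le> quad A0 b0 c0 xhat"
      using le by (simp add: pen_objective_eq H_def t_def)
    moreover note L(2)[of x, folded t_def]
    ultimately have main: "(\<eta> - C) * trace H + (\<eta> - L) * t\<^sup>2 \<le> L * t"
      by (simp add: algebra_simps)
    have "0 < L / \<delta>" using L(1) assms(4) by simp
    then have gaps: "1 \<le> \<eta> - C" "L / \<delta> + 1 \<le> \<eta> - L" "0 < \<eta> - L"
      using \<eta> L(1) C0 unfolding \<eta>1_def by linarith+
    have t0: "0 \<le> t" by (simp add: t_def)
    have t: "t \<le> \<delta>"
    proof (rule ccontr)
      assume "\<not> t \<le> \<delta>"
      then have "\<delta> < t" by simp
      have "(\<eta> - L) * t\<^sup>2 \<le> L * t" using main mult_nonneg_nonneg[of "\<eta> - C" "trace H"] gaps tr by linarith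
      then have "((\<eta> - L) * t) * t \<le> L * t" by (simp add: power2_eq_square mult.assoc)
      then have "(\<eta> - L) * t \<le> L" using \<open>\<delta> < t\<close> assms(4) by simp
      moreover have "(L / \<delta> + 1) * t \<le> (\<eta> - L) * t" using gaps t0 by (intro mult_right_mono)
      moreover have "(L / \<delta>) * \<delta> < (L / \<delta> + 1) * t"
        using \<open>\<delta> < t\<close> assms(4) \<open>0 < L / \<delta>\<close> by (intro mult_strict_mono) linarith+
      ultimately show False using assms(4) by simp
    qed
    have "trace H \<le> (\<eta> - C) * trace H" using mult_right_mono[OF gaps(1) tr] by simp
    also have "\<dots> \<le> L * t" using main gaps(3) by (smt (verit) mult_nonneg_nonneg zero_le_power2)
    also have "\<dots> \<le> L * \<delta>" using t L(1) by simp
    finally have trb: "trace H \<le> L * \<delta>" .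
    have "norm H \<le> N * trace H" unfolding N_def by (rule norm_le_trace_cone_psd[OF H assms(2,3)])
    also have "\<dots> \<le> N * (L * \<delta>)" using trb by (intro mult_left_mono) (auto simp: N_def)
    finally have nH: "norm H \<le> N * (L * \<delta>)" .
    have "norm x \<le> norm xhat + \<delta>"
      using t norm_triangle_ineq[of xhat "x - xhat"] by (simp add: t_def)
    then have "norm (outer x) \<le> (norm xhat + \<delta>)\<^sup>2"
      unfolding norm_outer by (intro power_mono) auto
    moreover have "norm X \<le> norm H + norm (outer x)"
      using norm_triangle_ineq[of H "outer x"] by (simp add: H_def)
    ultimately have "norm X \<le> R" using nH unfolding R_def by linarith
    then show ?thesis using t by (simp add: t_def)
  qed
  then show ?thesis by blast
qed

text \<open>A lifted point with \<open>H = X - x x\<^sup>T\<close> violates the original constraints by \<open>O(tr H)\<close>, so \<open>x\<close>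
  can be repaired at distance \<open>O(tr H)\<close>. Near \<open>xhat\<close> this costs less than the penalty
  \<open>\<eta> tr H\<close> saved.\<close>

lemma pen_rank_one_improves:
  fixes I E :: "'k set" and A0 :: "real^'n^'n" and A :: "'k \<Rightarrow> real^'n^'n" and xhat :: "real^'n"
  assumes fin: "finite I" "finite E" and disj: "I \<inter> E = {}"
    and sym0: "A0 \<in> symmetric_matrices"
    and sym: "\<And>k. k \<in> I \<union> E \<Longrightarrow> A k \<in> symmetric_matrices"
    and r: "2 \<le> r" "r \<le> CARD('n)"
    and feas: "xhat \<in> qcqp_feasible I E A b c"
    and licq: "licq I E A b c xhat"
  shows "\<exists>\<eta>1. \<exists>\<delta>>0. \<forall>\<eta>\<ge>\<eta>1. \<forall>(x, X)\<in>pen_feasible r I E A b c. norm (x - xhat) \<le> \<delta> \<longrightarrow> X \<noteq> outer x \<longrightarrow>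
    (\<exists>z\<in>qcqp_feasible I E A b c.
      pen_objective A0 b0 c0 xhat \<eta> (z, outer z) < pen_objective A0 b0 c0 xhat \<eta> (x, X))"
proof -
  define q where "q j = quad (A j) (b j) (c j)" for j
  define J where "J = {k \<in> I \<union> E. q k xhat = 0}"
  define v where "v x = (\<Sum>j\<in>J. violation E j (q j x))" for x
  have finJ: "finite J" using fin by (simp add: J_def)
  \<comment> \<open>Equalities are active at a feasible point, so outside \<open>J\<close> only
    strict inequalities remain.\<close>
  have EJ: "E \<subseteq> J" using feas by (auto simp: J_def q_def qcqp_feasible_def)
  have symJ: "A j \<in> symmetric_matrices" if "j \<in> J" for j using that sym by (auto simp: J_def)
  have active: "q j xhat = 0" if "j \<in> J" for j using that by (simp add: J_def)
  obtain w where w: "\<And>j k. j \<in> J \<Longrightarrow> k \<in> J \<Longrightarrow> gradient (q j) xhat \<bullet> w k = (if j = k then 1 else 0)"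
    using licq licq_dual_basis[of "\<lambda>k. gradient (q k) xhat" J]
    unfolding licq_def Let_def J_def q_def by blast
  have dual: "(2 *\<^sub>R (A j *v xhat + b j)) \<bullet> w k = (if j = k then 1 else 0)" if "j \<in> J" "k \<in> J" for j k
    using w[OF that] unfolding q_def gradient_quad[OF symJ[OF that(1)]] .
  obtain \<kappa> \<rho>0 where \<kappa>: "0 < \<kappa>" and \<rho>0: "0 < \<rho>0" and bound: "\<And>\<rho>. 0 < \<rho> \<Longrightarrow> \<rho> \<le> \<rho>0 \<Longrightarrow>
      \<exists>\<delta>>0. \<forall>x\<in>cball xhat \<delta>. \<exists>z\<in>cball xhat \<rho>. v z = 0 \<and> norm (z - x) \<le> \<kappa> * v x"
    using quad_error_bound[OF finJ symJ dual active[unfolded q_def], of E] unfolding v_def q_def by blast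
  \<comment> \<open>Inactive inequalities stay strict near \<open>xhat\<close>, so the repair need
    only treat \<open>J\<close>.\<close>
  have "\<forall>\<^sub>F x in nhds xhat. \<forall>j\<in>I - J. q j x < 0"
  proof (intro eventually_ball_finite ballI)
    show "finite (I - J)" using fin by simp
    fix j assume j: "j \<in> I - J"
    then have "q j xhat < 0" using feas by (force simp: J_def q_def qcqp_feasible_def)
    moreover have "isCont (q j) xhat"
      using continuous_on_quad[of UNIV "A j" "b j" "c j"] by (simp add: q_def continuous_on_eq_continuous_at)
    ultimately show "\<forall>\<^sub>F x in nhds xhat. q j x < 0"
      by (auto simp: continuous_at intro: order_tendstoD(2) dest: tendsto_at_iff_tendsto_nhds[THEN iffD1])
  qed
  then obtain d where d: "0 < d" "\<And>x. dist x xhat < d \<Longrightarrow> \<forall>j\<in>I - J. q j x < 0"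
    unfolding eventually_nhds_metric by blast
  obtain L where L: "0 < L" "\<And>x y. x \<in> cball xhat 1 \<Longrightarrow> y \<in> cball xhat 1 \<Longrightarrow>
      \<bar>quad A0 b0 c0 y - quad A0 b0 c0 x\<bar> \<le> L * norm (y - x)"
    using quad_lipschitz[OF sym0, of xhat b0 c0] by blast
  define N where "N = (real CARD('n))\<^sup>2"
  define C0 where "C0 = norm A0 * N"
  define C where "C = (\<Sum>j\<in>J. norm (A j) * N)"
  have C: "0 \<le> C" unfolding C_def N_def by (intro sum_nonneg) auto
  \<comment> \<open>The caps serve, in order, the error bound, the inactive constraints, the
    Lipschitz ball, and the growth of the proximal term. The added 1 covers
    \<open>C = 0\<close>.\<close>
  define \<rho> where "\<rho> = min (min \<rho>0 (d / 2)) (min 1 (1 / (4 * (\<kappa> * C + 1))))"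
  have \<kappa>C: "0 \<le> \<kappa> * C" using \<kappa> C by simp
  have "0 < 1 / (4 * (\<kappa> * C + 1))" using \<kappa>C by (intro divide_pos_pos) auto
  then have \<rho>: "0 < \<rho>" "\<rho> \<le> \<rho>0" "\<rho> \<le> 1" "\<rho> < d" "\<rho> \<le> 1 / (4 * (\<kappa> * C + 1))"
    using \<rho>0 d(1) by (auto simp: \<rho>_def)
  have small: "\<kappa> * C * \<rho> \<le> 1 / 4"
  proof -
    have "(\<kappa> * C + 1) * \<rho> \<le> 1 / 4" using \<rho>(5) \<kappa>C by (simp add: field_simps)
    then show ?thesis using \<rho>(1) by (simp add: algebra_simps)
  qed
  obtain \<delta>' where \<delta>': "0 < \<delta>'"
    "\<And>x. x \<in> cball xhat \<delta>' \<Longrightarrow> \<exists>z\<in>cball xhat \<rho>. v z = 0 \<and> norm (z - x) \<le> \<kappa> * v x"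
    using bound[OF \<rho>(1,2)] by blast
  define \<delta> where "\<delta> = min \<delta>' \<rho>"
  \<comment> \<open>The loss per unit of trace is doubled because the proximal term may consume half
    of the saved penalty.\<close>
  define \<eta>1 where "\<eta>1 = 2 * (L * \<kappa> * C + C0) + 1"
  have "0 \<le> C0" by (simp add: C0_def N_def)
  have "\<exists>z\<in>qcqp_feasible I E A b c.
      pen_objective A0 b0 c0 xhat \<eta> (z, outer z) < pen_objective A0 b0 c0 xhat \<eta> (x, X)"
    if \<eta>: "\<eta>1 \<le> \<eta>" and pf: "(x, X) \<in> pen_feasible r I E A b c"
      and x: "norm (x - xhat) \<le> \<delta>" and X: "X \<noteq> outer x" for \<eta> x X
  proof -
    define H where "H = X - outer x"
    define \<tau> where "\<tau> = trace H"
    have H: "H \<in> cone_psd r" using pf by (simp add: pen_feasible_iff H_def)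
    have \<tau>: "0 < \<tau>" unfolding \<tau>_def using trace_cone_psd_pos(2)[OF H r] X by (simp add: H_def)
    have "violation E j (q j x) \<le> norm (A j) * N * \<tau>" if "j \<in> J" for j
    proof -
      have "\<bar>A j \<bullet> H\<bar> \<le> norm (A j) * N * \<tau>"
        unfolding N_def \<tau>_def by (rule inner_cone_psd_bound[OF H r])
      moreover have "j \<in> E \<Longrightarrow> q j x + A j \<bullet> H = 0" "j \<notin> E \<Longrightarrow> q j x + A j \<bullet> H \<le> 0"
        using pf that by (auto simp: pen_feasible_iff J_def q_def H_def)
      ultimately show ?thesis by (cases "j \<in> E") (auto simp: violation_def)
    qed
    then have "v x \<le> (\<Sum>j\<in>J. norm (A j) * N * \<tau>)" unfolding v_def by (intro sum_mono)
    then have vx: "v x \<le> C * \<tau>" by (simp add: C_def sum_distrib_right)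
    have xd: "x \<in> cball xhat \<delta>'" "norm (x - xhat) \<le> \<rho>"
      using x by (auto simp: \<delta>_def dist_norm norm_minus_commute)
    obtain z where z: "z \<in> cball xhat \<rho>" "v z = 0" "norm (z - x) \<le> \<kappa> * v x"
      using \<delta>'(2)[OF xd(1)] by blast
    have z\<rho>: "norm (z - xhat) \<le> \<rho>" using z(1) by (simp add: dist_norm norm_minus_commute)
    have "\<kappa> * v x \<le> \<kappa> * (C * \<tau>)" using vx \<kappa> by simp
    with z(3) have zx: "norm (z - x) \<le> \<kappa> * C * \<tau>" by (simp add: mult.assoc)
    have "violation E j (q j z) = 0" if "j \<in> J" for j
      using z(2) that finJ unfolding v_def by (subst (asm) sum_nonneg_eq_0_iff) (auto simp: violation_nonneg)
    then have viol: "j \<in> J \<Longrightarrow> j \<in> E \<Longrightarrow> q j z = 0" "j \<in> J \<Longrightarrow> j \<notin> E \<Longrightarrow> q j z \<le> 0" for j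
      by (force simp: violation_def)+
    have "q j z \<le> 0" if "j \<in> I" for j
    proof (cases "j \<in> J")
      case True
      then show ?thesis using viol(2) that disj by blast
    next
      case False
      have "dist z xhat < d" using z\<rho> \<rho>(4) by (simp add: dist_norm)
      then show ?thesis using d(2) False that by (auto intro: less_imp_le)
    qed
    then have zF: "z \<in> qcqp_feasible I E A b c"
      using viol(1) EJ by (auto simp: qcqp_feasible_def q_def)
    have "\<bar>A0 \<bullet> H\<bar> \<le> C0 * \<tau>"
      unfolding C0_def N_def \<tau>_def by (rule inner_cone_psd_bound[OF H r])
    moreover have "quad A0 b0 c0 z \<le> quad A0 b0 c0 x + L * \<kappa> * C * \<tau>"
    proof -
      have "\<bar>quad A0 b0 c0 z - quad A0 b0 c0 x\<bar> \<le> L * norm (z - x)"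
        using xd(2) z\<rho> \<rho>(3) by (intro L(2)) (auto simp: dist_norm norm_minus_commute)
      also have "\<dots> \<le> L * (\<kappa> * C * \<tau>)" using zx L(1) by simp
      finally show ?thesis by (simp add: mult.assoc)
    qed
    \<comment> \<open>This term is multiplied by \<eta>, so enlarging \<eta> cannot beat it.
      Factoring the difference of squares brings in the small factor \<open>2 * \<rho>\<close>
      instead.\<close>
    moreover have "(norm (z - xhat))\<^sup>2 \<le> (norm (x - xhat))\<^sup>2 + \<tau> / 2"
    proof -
      have "norm (z - xhat) - norm (x - xhat) \<le> norm (z - x)"
        using norm_triangle_ineq[of "z - x" "x - xhat"] by simp
      then have "norm (z - xhat) - norm (x - xhat) \<le> \<kappa> * C * \<tau>" using zx by simp
      then have "(norm (z - xhat) + norm (x - xhat)) * (norm (z - xhat) - norm (x - xhat))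
          \<le> (norm (z - xhat) + norm (x - xhat)) * (\<kappa> * C * \<tau>)"
        by (intro mult_left_mono) auto
      also have "\<dots> \<le> (\<rho> + \<rho>) * (\<kappa> * C * \<tau>)"
        using z\<rho> xd(2) \<kappa>C \<tau> by (intro mult_right_mono add_mono) auto
      also have "\<dots> = 2 * (\<kappa> * C * \<rho>) * \<tau>" by simp
      also have "\<dots> \<le> 2 * (1 / 4) * \<tau>" using small \<tau> by (intro mult_right_mono) auto
      finally show ?thesis by (simp add: power2_eq_square algebra_simps)
    qed
    then have "\<eta> * (norm (z - xhat))\<^sup>2 \<le> \<eta> * ((norm (x - xhat))\<^sup>2 + \<tau> / 2)"
      using \<eta> L(1) \<kappa>C \<open>0 \<le> C0\<close> by (intro mult_left_mono) (auto simp: \<eta>1_def mult.assoc intro: order_trans[rotated])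
    moreover have "(L * \<kappa> * C + C0) * \<tau> < \<eta> / 2 * \<tau>"
      using \<eta> \<tau> by (intro mult_strict_right_mono) (auto simp: \<eta>1_def)
    ultimately have "quad A0 b0 c0 z + \<eta> * (norm (z - xhat))\<^sup>2
        < quad A0 b0 c0 x + A0 \<bullet> H + \<eta> * (\<tau> + (norm (x - xhat))\<^sup>2)"
      by (simp add: algebra_simps)
    then show ?thesis using zF
      by (intro bexI[of _ z]) (simp_all add: pen_objective_eq H_def \<tau>_def trace_zero)
  qed
  moreover have "0 < \<delta>" using \<delta>'(1) \<rho>(1) by (simp add: \<delta>_def)
  ultimately show ?thesis by blast
qed

section \<open>Existence, rank one, uniqueness and descent\<close>

theorem theorem1:
  fixes I E :: "'k set"
    and A0 :: "real^'n^'n" and b0 :: "real^'n" and c0 :: real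
    and A :: "'k \<Rightarrow> real^'n^'n" and b :: "'k \<Rightarrow> real^'n" and c :: "'k \<Rightarrow> real"
    and xhat :: "real^'n" and r :: nat
  assumes "finite I" and "finite E" and "I \<inter> E = {}"
    and "A0 \<in> symmetric_matrices"
    and "\<And>k. k \<in> I \<union> E \<Longrightarrow> A k \<in> symmetric_matrices"
    and "2 \<le> r" and "r \<le> CARD('n)"
    and "xhat \<in> qcqp_feasible I E A b c"
    and "licq I E A b c xhat"
  shows "\<exists>\<eta>0. \<forall>\<eta>\<ge>\<eta>0. 0 < \<eta> \<longrightarrow>
    (\<exists>x X. pen_optimal r I E A0 b0 c0 A b c xhat \<eta> (x, X) \<and>
           (\<forall>z. pen_optimal r I E A0 b0 c0 A b c xhat \<eta> z \<longrightarrow> z = (x, X)) \<and>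
           X = outer x \<and>
           x \<in> qcqp_feasible I E A b c \<and>
           quad A0 b0 c0 x \<le> quad A0 b0 c0 xhat)"
proof -
  obtain \<eta>1 \<delta> where \<delta>: "0 < \<delta>" and improve: "\<And>\<eta> x X. \<eta>1 \<le> \<eta> \<Longrightarrow> (x, X) \<in> pen_feasible r I E A b c \<Longrightarrow>
      norm (x - xhat) \<le> \<delta> \<Longrightarrow> X \<noteq> outer x \<Longrightarrow> \<exists>z\<in>qcqp_feasible I E A b c.
        pen_objective A0 b0 c0 xhat \<eta> (z, outer z) < pen_objective A0 b0 c0 xhat \<eta> (x, X)"
    using pen_rank_one_improves[OF assms, of b0 c0] by blast
  obtain \<eta>2 R where local: "\<And>\<eta> x X. \<eta>2 \<le> \<eta> \<Longrightarrow> (x, X) \<in> pen_feasible r I E A b c \<Longrightarrow>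
      pen_objective A0 b0 c0 xhat \<eta> (x, X) \<le> quad A0 b0 c0 xhat \<Longrightarrow> norm (x - xhat) \<le> \<delta> \<and> norm X \<le> R"
    using pen_sublevel_localised[OF assms(4,6,7) \<delta>, of I E A b c b0 c0 xhat] by blast
  show ?thesis
  proof (intro exI[of _ "max \<eta>1 \<eta>2"] allI impI)
    fix \<eta> :: real assume "max \<eta>1 \<eta>2 \<le> \<eta>" and pos: "0 < \<eta>"
    then have \<eta>: "\<eta>1 \<le> \<eta>" "\<eta>2 \<le> \<eta>" by auto
    let ?F = "pen_feasible r I E A b c" and ?f = "pen_objective A0 b0 c0 xhat \<eta>"
    have hat: "(xhat, outer xhat) \<in> ?F" "?f (xhat, outer xhat) = quad A0 b0 c0 xhat"
      using assms(8) by (simp_all add: outer_pen_feasible_iff pen_objective_eq trace_zero)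
    \<comment> \<open>A minimiser is no worse than \<open>xhat\<close>, hence close to it, where a
      point with \<open>X \<noteq> outer x\<close> could be improved. The claim serves the
      constructed minimiser, any competitor, and their midpoint.\<close>
    have opt: "X = outer x" if z: "(x, X) \<in> ?F" "\<And>y. y \<in> ?F \<Longrightarrow> ?f (x, X) \<le> ?f y" for x X
    proof (rule ccontr)
      assume "X \<noteq> outer x"
      moreover have "norm (x - xhat) \<le> \<delta>" using local[OF \<eta>(2) z(1)] z(2)[OF hat(1)] hat(2) by simp
      ultimately obtain y where "y \<in> qcqp_feasible I E A b c" "?f (y, outer y) < ?f (x, X)"
        using improve[OF \<eta>(1) z(1)] by blast
      then show False using z(2)[of "(y, outer y)"] by (simp add: outer_pen_feasible_iff)
    qed
    have cont: "continuous_on S ?f" for S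
      unfolding pen_objective_def quad_lift_def trace_def split_beta by (intro continuous_intros)
    \<comment> \<open>A compact part of the feasible set that contains every feasible point at least
      as good as \<open>xhat\<close>, so its minimiser is global.\<close>
    let ?S = "?F \<inter> (cball xhat \<delta> \<times> cball 0 R)"
    have hatS: "(xhat, outer xhat) \<in> ?S"
      using hat local[OF \<eta>(2) hat(1)] \<delta> by (simp add: dist_norm)
    have "compact ?S"
      by (intro closed_Int_compact closed_pen_feasible compact_Times compact_cball)
    then obtain s where s: "s \<in> ?S" "\<And>y. y \<in> ?S \<Longrightarrow> ?f s \<le> ?f y"
      using continuous_attains_inf[OF _ _ cont, of ?S] hatS by blast
    have min: "?f s \<le> ?f y" if y: "y \<in> ?F" for y
    proof (cases "?f y \<le> quad A0 b0 c0 xhat")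
      case True
      then have "y \<in> ?S"
        using local[OF \<eta>(2), of "fst y" "snd y"] y
        by (cases y) (auto simp: dist_norm norm_minus_commute)
      then show ?thesis by (rule s(2))
    next
      case False
      then show ?thesis using s(2)[OF hatS] hat(2) by linarith
    qed
    obtain x X where sx: "s = (x, X)" by fastforce
    have x: "(x, X) \<in> ?F" using s(1) sx by simp
    have X: "X = outer x" using opt[OF x] min sx by simp
    have "(y, Y) = (x, X)" if y: "(y, Y) \<in> ?F" and ymin: "\<And>w. w \<in> ?F \<Longrightarrow> ?f (y, Y) \<le> ?f w" for y Y
    proof -
      have Y: "Y = outer y" using opt[OF y] ymin by simp
      let ?m = "((1/2) *\<^sub>R (x + y), (1/2) *\<^sub>R (outer x + outer y))"
      have m: "?m \<in> ?F" using x y unfolding X Y by (rule pen_feasible_midpoint)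
      have "?f (x, X) = ?f (y, Y)" using min[OF y] ymin[OF x] sx by simp
      then have "?f ?m = ?f (x, X)" by (simp add: pen_objective_midpoint X Y)
      \<comment> \<open>The midpoint is optimal too, so it has rank-one form and its defect
        \<open>outer (x - y)\<close> vanishes.\<close>
      then have "(1/2) *\<^sub>R (outer x + outer y) = outer ((1/2) *\<^sub>R (x + y))"
        using opt[OF m] min sx by simp
      then have "outer (x - y) = 0" using outer_midpoint[of x y] by simp
      then show ?thesis by (simp add: outer_eq_0_iff X Y)
    qed
    then have unique: "z = (x, X)" if "pen_optimal r I E A0 b0 c0 A b c xhat \<eta> z" for z
      using that by (cases z) (auto simp: pen_optimal_def is_arg_min_def not_less)
    have optimal: "pen_optimal r I E A0 b0 c0 A b c xhat \<eta> (x, X)"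
      using x min sx by (auto simp: pen_optimal_def is_arg_min_def not_less)
    have "?f (x, X) \<le> quad A0 b0 c0 xhat" using min[OF hat(1)] hat(2) sx by simp
    then have "quad A0 b0 c0 x + \<eta> * (norm (x - xhat))\<^sup>2 \<le> quad A0 b0 c0 xhat"
      by (simp add: X pen_objective_eq trace_zero)
    moreover have "0 \<le> \<eta> * (norm (x - xhat))\<^sup>2" using pos by simp
    ultimately have "quad A0 b0 c0 x \<le> quad A0 b0 c0 xhat" by linarith
    then show "\<exists>x X. pen_optimal r I E A0 b0 c0 A b c xhat \<eta> (x, X) \<and>
           (\<forall>z. pen_optimal r I E A0 b0 c0 A b c xhat \<eta> z \<longrightarrow> z = (x, X)) \<and>
           X = outer x \<and>
           x \<in> qcqp_feasible I E A b c \<and>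
           quad A0 b0 c0 x \<le> quad A0 b0 c0 xhat"
      using optimal unique X x outer_pen_feasible_iff by blast
  qed
qed

end
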